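(* Let $(X,V,W,S,\mathcal H_*,h,*,\Theta)$ satisfy the abstract symmetrization framework described in the context. Assume that $f:X\to\mathbb R\cup\{+\infty\}$ is a proper, lower semi-continuous functional bounded from below such that $f(u^H)\le f(u)$ for all $u\in S$ and $H\in\mathcal H_*$. Then for every $\rho_1,\rho_2>0$, $\sigma>0$ and $u\in S$ such that $f(u)<\inf_X f+\sigma\rho_1$, there exists a point $v\in X$ such that: (a) $\|v-v^*\|_V<(K(C_\Theta+1)+1)(\rho_1+\rho_2)$; (b) $f(w)\ge f(v)-\sigma\|w-v\|$ for all $w\in X$; (c) for every sequence $(u_h)\subset X$, if $\lim_h\big(f(u_h)+\sigma\|u_h-v\|\big)=f(v)$, then $\lim_h u_h=v$.
   Context: Abstract framework. $X,V,W$ are real Banach spaces with $X\subseteq V\subseteq W$, $X$ continuously embedded in $V$ and $V$ continuously embedded in $W$; $\|\cdot\|$ is the norm of $X$ and $K>0$ is a continuity constant of $X\hookrightarrow V$, i.e. $\|u\|_V\le K\|u\|$ for $u\in X$. $S\subseteq X$ carries the metric induced by $\|\cdot\|$, $\mathcal H_*$ is a path-connected topological space, and there are maps $*:S\to S$, $u\mapsto u^*$ (symmetrization) and $h:S\times\mathcal H_*\to S$, $(u,H)\mapsto u^H$ (polarization) such that: $h$ is continuous; $(u^* )^H=(u^H)^*=u^*$ and $(u^H)^H=u^H$ for all $u\in S$, $H\in\mathcal H_*$; there is a sequence $(H_m)\subset\mathcal H_*$ such that for every $u\in S$ the iterated polarizations $u^{H_1\cdots H_m}$ converge to $u^*$ in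 $V$ as $m\to\infty$; $\|u^H-v^H\|_V\le\|u-v\|_V$ for all $u,v\in S$, $H\in\mathcal H_*$. Moreover $\Theta:(X,\|\cdot\|_V)\to(S,\|\cdot\|_V)$ is Lipschitz with constant $C_\Theta>0$ and $\Theta|_S=\mathrm{Id}|_S$; for $u\in X$ one sets $u^H:=(\Theta(u))^H$ and $u^*:=(\Theta(u))^*$. Proper means not identically $+\infty$. *)

theory Defs
  imports "HOL-Analysis.Analysis"
begin

definition lower_semicont :: "('a::topological_space \<Rightarrow> ereal) \<Rightarrow> bool" where
  "lower_semicont f \<longleftrightarrow> (\<forall>x a. a < f x \<longrightarrow> (\<forall>\<^sub>F y in nhds x. a < f y))"

definition proper :: "('a \<Rightarrow> ereal) \<Rightarrow> bool" where
  "proper f \<longleftrightarrow> (\<exists>u. f u \<noteq> \<infinity>)"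

definition bounded_from_below :: "('a \<Rightarrow> ereal) \<Rightarrow> bool" where
  "bounded_from_below f \<longleftrightarrow> (\<exists>c::real. \<forall>u. ereal c \<le> f u)"

text \<open>The iterated polarization of \<open>u\<close> by \<open>Hs 0\<close>, then \<open>Hs 1\<close>, up to \<open>Hs (m - 1)\<close>.\<close>

primrec iter_pol :: "('x \<Rightarrow> 'h \<Rightarrow> 'x) \<Rightarrow> (nat \<Rightarrow> 'h) \<Rightarrow> 'x \<Rightarrow> nat \<Rightarrow> 'x" where
  "iter_pol h Hs u 0 = u"
| "iter_pol h Hs u (Suc m) = h (iter_pol h Hs u m) (Hs m)"

text \<open>
  The inclusions \<open>X \<subseteq> V \<subseteq> W\<close> are the injective bounded linear maps \<open>i\<close> and \<open>j\<close>, so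
  \<open>norm (i u)\<close> is the norm of \<open>u \<in> X\<close> in \<open>V\<close>. The maps \<open>star\<close> and \<open>h\<close> only matter on \<open>S\<close> and
  \<open>S \<times> topspace HH\<close>; for arbitrary \<open>u \<in> X\<close> one writes \<open>star (\<Theta> u)\<close> and \<open>h (\<Theta> u) H\<close>.
\<close>

locale symmetrization_framework =
  fixes i :: "'x::banach \<Rightarrow> 'v::banach"
    and j :: "'v \<Rightarrow> 'w::banach"
    and K :: real
    and S :: "'x set"
    and HH :: "'h topology"
    and h :: "'x \<Rightarrow> 'h \<Rightarrow> 'x"
    and star :: "'x \<Rightarrow> 'x"
    and \<Theta> :: "'x \<Rightarrow> 'x"
    and C :: real
  assumes embed_XV: "bounded_linear i" "inj i"
    and embed_VW: "bounded_linear j" "inj j"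
    and K_pos: "K > 0"
    and K_bound: "norm (i u) \<le> K * norm u"
    and path_connected_HH: "path_connected_space HH"
    and star_closed: "u \<in> S \<Longrightarrow> star u \<in> S"
    and h_closed: "u \<in> S \<Longrightarrow> H \<in> topspace HH \<Longrightarrow> h u H \<in> S"
    and h_continuous:
      "continuous_map (prod_topology (top_of_set S) HH) (top_of_set S) (\<lambda>(u, H). h u H)"
    and pol_of_star: "u \<in> S \<Longrightarrow> H \<in> topspace HH \<Longrightarrow> h (star u) H = star u"
    and star_of_pol: "u \<in> S \<Longrightarrow> H \<in> topspace HH \<Longrightarrow> star (h u H) = star u"
    and pol_idem: "u \<in> S \<Longrightarrow> H \<in> topspace HH \<Longrightarrow> h (h u H) H = h u H"
    and iter_pol_approx:
      "\<exists>Hs. (\<forall>m. Hs m \<in> topspace HH) \<and>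
         (\<forall>u\<in>S. (\<lambda>m. i (iter_pol h Hs u m)) \<longlonglongrightarrow> i (star u))"
    and pol_contraction:
      "u \<in> S \<Longrightarrow> v \<in> S \<Longrightarrow> H \<in> topspace HH \<Longrightarrow>
         norm (i (h u H) - i (h v H)) \<le> norm (i u - i v)"
    and C_pos: "C > 0"
    and \<Theta>_closed: "\<Theta> u \<in> S"
    and \<Theta>_lipschitz: "norm (i (\<Theta> u) - i (\<Theta> v)) \<le> C * norm (i u - i v)"
    and \<Theta>_id: "u \<in> S \<Longrightarrow> \<Theta> u = u"

end

(*
  Apply Ekeland's principle to f with the smaller slope \<sigma>\<rho>\<^sub>1/(\<rho>\<^sub>1 + \<rho>\<^sub>2), starting not at u but at an
  iterated polarization x of u with i x close to i (star u): polarizing does not increase f and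
  does not change the symmetrization.  Since star inherits the V-contraction property of the
  polarizations, the distance from the resulting v to its symmetrization is controlled by the
  distances from v to x and from i x to i (star u).  The gap between the two slopes makes v a
  strong minimum of w \<mapsto> f w + \<sigma> norm (w - v), which is (c).
*)

theory Submission
  imports Defs
begin

text \<open>A real \<open>b\<close> strictly between \<open>g x\<close> and \<open>f x\<close>
  separates the two functions on a whole neighbourhood of \<open>x\<close>, so the complement is
  open. This gives the closedness of the sets \<open>T x\<close> in Ekeland's principle.\<close>

lemma closed_lower_semicont_le:
  fixes f :: "'a::topological_space \<Rightarrow> ereal" and g :: "'a \<Rightarrow> real"
  assumes f: "lower_semicont f" and g: "continuous_on UNIV g"
  shows "closed {y. f y \<le> ereal (g y)}"
proof -
  have "\<forall>\<^sub>F y in nhds x. ereal (g y) < f y" if x: "ereal (g x) < f x" for x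
  proof -
    obtain b where b: "ereal (g x) < ereal b" "ereal b < f x"
      using ereal_dense2[OF x] by blast
    have "(g \<longlongrightarrow> g x) (nhds x)"
      using g by (simp add: continuous_on_def tendsto_nhds_iff)
    then have "\<forall>\<^sub>F y in nhds x. g y < b"
      using b(1) order_tendstoD(2) by force
    moreover have "\<forall>\<^sub>F y in nhds x. ereal b < f y"
      using f b(2) unfolding lower_semicont_def by blast
    ultimately show ?thesis
      by eventually_elim (simp add: less_trans[of "ereal _" "ereal b"])
  qed
  then have "open {y. ereal (g y) < f y}"
    by (subst open_subopen) (force simp: eventually_nhds)
  then show ?thesis
    by (simp add: closed_def Collect_neg_eq[symmetric] not_le)
qed

text \<open>Greedy descent from \<open>x0\<close> yields nested closed sets whose diameters tend to
  0. By completeness they share exactly one point, and that point admits no further descent.\<close>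

theorem ekeland_variational_principle:
  fixes f :: "'a::complete_space \<Rightarrow> ereal"
  assumes lsc: "lower_semicont f" and bdd: "bounded_from_below f"
    and x0: "f x0 \<noteq> \<infinity>" and s: "s > 0"
  obtains v where "f v + ereal (s * dist x0 v) \<le> f x0"
    and "\<And>w. f v \<le> f w + ereal (s * dist v w)"
proof -
  obtain c :: real where c: "\<And>u. ereal c \<le> f u"
    using bdd unfolding bounded_from_below_def by blast
  \<comment> \<open>\<open>real_of_ereal\<close> sends \<infinity> to 0, so \<open>g\<close>
    represents \<open>f\<close> only at points of finite value; the facts below therefore track
    finiteness.\<close>
  define g where "g = (\<lambda>x. real_of_ereal (f x))"
  have fg: "f x = ereal (g x)" if "f x \<noteq> \<infinity>" for x
    using that c[of x] unfolding g_def by (cases "f x") auto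
  \<comment> \<open>\<open>T x\<close> is the set of points below \<open>x\<close> in Ekeland's
    order; \<open>T_refl\<close> and \<open>T_mono\<close> are its reflexivity and transitivity. The
    real bound makes every member a point of finite value.\<close>
  define T where "T = (\<lambda>x. {y. f y \<le> ereal (g x - s * dist x y)})"
  have T_fin: "f y \<noteq> \<infinity>" if "y \<in> T x" for x y
    using that unfolding T_def by auto
  have T_g: "g y + s * dist x y \<le> g x" if "y \<in> T x" for x y
    using that fg[OF T_fin[OF that]] unfolding T_def by simp
  have T_I: "y \<in> T x" if "f y \<noteq> \<infinity>" "g y + s * dist x y \<le> g x" for x y
    using that fg[of y] unfolding T_def by simp
  have T_refl: "x \<in> T x" if "f x \<noteq> \<infinity>" for x
    using that by (auto intro: T_I)
  have T_mono: "T y \<subseteq> T x" if y: "y \<in> T x" for x y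
  proof
    fix z assume z: "z \<in> T y"
    have "s * dist x z \<le> s * dist x y + s * dist y z"
      using s dist_triangle[of x z y] by (simp flip: distrib_left)
    with T_g[OF z] T_g[OF y] show "z \<in> T x"
      by (intro T_I T_fin[OF z]) linarith
  qed
  have g_ge: "c \<le> g y" if "f y \<noteq> \<infinity>" for y
    using c[of y] fg[OF that] by simp
  \<comment> \<open>The next point minimizes \<open>g\<close> over \<open>T x\<close> up to
    \<open>(1/2)^n\<close>. The clause about \<open>n = 0\<close> only serves to make the chosen
    sequence start at \<open>x0\<close>.\<close>
  have step: "\<exists>y. (f y \<noteq> \<infinity> \<and> (Suc n = 0 \<longrightarrow> y = x0)) \<and>
      (y \<in> T x \<and> (\<forall>z\<in>T x. g y \<le> g z + (1/2)^n))"
    if "f x \<noteq> \<infinity> \<and> (n = 0 \<longrightarrow> x = x0)" for x and n :: nat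
  proof -
    have ne: "T x \<noteq> {}" using T_refl that by blast
    have bd: "bdd_below (g ` T x)"
      using g_ge T_fin by (intro bdd_belowI2[where m = c]) blast
    have "(INF z\<in>T x. g z) < (INF z\<in>T x. g z) + (1/2)^n" by simp
    then obtain y where y: "y \<in> T x" "g y < (INF z\<in>T x. g z) + (1/2)^n"
      using cINF_less_iff[OF ne bd] by blast
    have "g y \<le> g z + (1/2)^n" if "z \<in> T x" for z
      using y(2) cINF_lower[OF bd that] by linarith
    with y T_fin show ?thesis by auto
  qed
  obtain X where X: "\<And>n. (f (X n) \<noteq> \<infinity> \<and> (n = 0 \<longrightarrow> X n = x0)) \<and>
      (X (Suc n) \<in> T (X n) \<and> (\<forall>z\<in>T (X n). g (X (Suc n)) \<le> g z + (1/2)^n))"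
    using dependent_nat_choice[where P = "\<lambda>n x. f x \<noteq> \<infinity> \<and> (n = 0 \<longrightarrow> x = x0)"
        and Q = "\<lambda>n x y. y \<in> T x \<and> (\<forall>z\<in>T x. g y \<le> g z + (1/2)^n)"] x0 step
    by auto
  \<comment> \<open>Since \<open>y\<close> already lies in \<open>T (X n)\<close>, where
    \<open>X (Suc n)\<close> is almost minimal, \<open>g\<close> can drop by at most
    \<open>(1/2)^n\<close> from \<open>X (Suc n)\<close> to \<open>y\<close>; this drop dominates
    the scaled distance.\<close>
  have X_dist: "s * dist (X (Suc n)) y \<le> (1/2)^n" if y: "y \<in> T (X (Suc n))" for n y
  proof -
    have "y \<in> T (X n)" using y X[of n] T_mono by blast
    then have "g (X (Suc n)) \<le> g y + (1/2)^n" using X[of n] by blast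
    with T_g[OF y] show ?thesis by linarith
  qed
  have "\<exists>v. \<Inter> (range (\<lambda>n. T (X n))) = {v}"
  proof (rule decreasing_closed_nest_sing)
    show "closed (T (X n))" for n
      unfolding T_def by (intro closed_lower_semicont_le lsc continuous_intros)
    show "T (X n) \<noteq> {}" for n
      using T_refl X by blast
    show "T (X n) \<subseteq> T (X m)" if "m \<le> n" for m n
      by (rule lift_Suc_antimono_le[of "\<lambda>n. T (X n)", OF _ that]) (use X T_mono in blast)
    show "\<exists>n. \<forall>x\<in>T (X n). \<forall>y\<in>T (X n). dist x y < e" if e: "e > 0" for e
    proof -
      obtain n where n: "(1/2::real)^n < s * e / 2"
        using real_arch_pow_inv[of "s * e / 2" "1/2"] s e by auto
      have "dist x y < e" if x: "x \<in> T (X (Suc n))" and y: "y \<in> T (X (Suc n))" for x y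
      proof -
        have "s * dist x y \<le> s * dist (X (Suc n)) x + s * dist (X (Suc n)) y"
          using s dist_triangle3[of x y "X (Suc n)"] by (simp flip: distrib_left)
        also have "\<dots> < s * e"
          using X_dist[OF x] X_dist[OF y] n by linarith
        finally show ?thesis using s by simp
      qed
      then show ?thesis by blast
    qed
  qed
  then obtain v where v: "\<Inter> (range (\<lambda>n. T (X n))) = {v}" by blast
  then have v_in: "v \<in> T (X n)" for n by blast
  have v_fin: "f v \<noteq> \<infinity>" using T_fin v_in by blast
  have "v \<in> T x0" using v_in[of 0] X[of 0] by simp
  from T_g[OF this] have "f v + ereal (s * dist x0 v) \<le> f x0"
    by (simp add: fg[OF v_fin] fg[OF x0])
  moreover have "f v \<le> f w + ereal (s * dist v w)" for w
  \<comment> \<open>A violating \<open>w\<close> would lie in \<open>T v\<close>, hence in every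
    \<open>T (X n)\<close>, hence equal \<open>v\<close>, where the inequality is trivial.\<close>
  proof (rule ccontr)
    assume less: "\<not> ?thesis"
    then have w: "f w \<noteq> \<infinity>" by auto
    have "w \<in> T v"
      using less by (intro T_I w) (simp add: fg[OF v_fin] fg[OF w])
    then have "w \<in> T (X n)" for n using T_mono v_in by blast
    then have "w = v" using v by blast
    with less show False by (simp add: zero_ereal_def[symmetric])
  qed
  ultimately show ?thesis using that by blast
qed

context symmetrization_framework
begin

lemma iter_pol_invariants:
  assumes "\<forall>m. Hs m \<in> topspace HH" "u \<in> S"
  shows "iter_pol h Hs u m \<in> S" "star (iter_pol h Hs u m) = star u"
proof -
  have "iter_pol h Hs u m \<in> S \<and> star (iter_pol h Hs u m) = star u"
    using assms by (induction m) (auto simp: h_closed star_of_pol)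
  then show "iter_pol h Hs u m \<in> S" "star (iter_pol h Hs u m) = star u" by auto
qed

text \<open>One sequence \<open>Hs\<close> approximates the symmetrizations of both points. Each
  polarization contracts the V-distance, and the non-strict bound survives the limit.\<close>

lemma star_contraction:
  assumes u: "u \<in> S" and v: "v \<in> S"
  shows "norm (i (star u) - i (star v)) \<le> norm (i u - i v)"
proof -
  obtain Hs where Hs: "\<forall>m. Hs m \<in> topspace HH"
    and lim: "\<And>u. u \<in> S \<Longrightarrow> (\<lambda>m. i (iter_pol h Hs u m)) \<longlonglongrightarrow> i (star u)"
    using iter_pol_approx by blast
  have "norm (i (iter_pol h Hs u m) - i (iter_pol h Hs v m)) \<le> norm (i u - i v)" for m
  proof (induction m)
    case (Suc m)
    then show ?case
      using pol_contraction[OF iter_pol_invariants(1)[OF Hs u] iter_pol_invariants(1)[OF Hs v] spec[OF Hs], of m m m]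
      by (auto intro: order_trans)
  qed simp
  then show ?thesis
    by (intro LIMSEQ_le_const2[OF tendsto_norm[OF tendsto_diff[OF lim[OF u] lim[OF v]]]]) auto
qed

end

theorem theorem2p12:
  fixes i :: "'x::banach \<Rightarrow> 'v::banach"
    and j :: "'v \<Rightarrow> 'w::banach"
    and S :: "'x set"
    and HH :: "'h topology"
    and h :: "'x \<Rightarrow> 'h \<Rightarrow> 'x"
    and star \<Theta> :: "'x \<Rightarrow> 'x"
    and K C :: real
    and f :: "'x \<Rightarrow> ereal"
  assumes "symmetrization_framework i j K S HH h star \<Theta> C"
    and "\<forall>u. f u \<noteq> -\<infinity>"
    and "proper f"
    and "lower_semicont f"
    and "bounded_from_below f"
    and "\<forall>u\<in>S. \<forall>H\<in>topspace HH. f (h u H) \<le> f u"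
  shows "\<forall>\<rho>\<^sub>1 \<rho>\<^sub>2 \<sigma> :: real. \<forall>u\<in>S.
    \<rho>\<^sub>1 > 0 \<longrightarrow> \<rho>\<^sub>2 > 0 \<longrightarrow> \<sigma> > 0 \<longrightarrow> f u < (INF w. f w) + ereal (\<sigma> * \<rho>\<^sub>1) \<longrightarrow>
    (\<exists>v.
      norm (i v - i (star (\<Theta> v))) < (K * (C + 1) + 1) * (\<rho>\<^sub>1 + \<rho>\<^sub>2) \<and>
      (\<forall>w. f w \<ge> f v - ereal (\<sigma> * norm (w - v))) \<and>
      (\<forall>us :: nat \<Rightarrow> 'x.
        (\<lambda>n. f (us n) + ereal (\<sigma> * norm (us n - v))) \<longlonglongrightarrow> f v \<longrightarrow> us \<longlonglongrightarrow> v))"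
proof (intro allI ballI impI)
  fix \<rho>\<^sub>1 \<rho>\<^sub>2 \<sigma> :: real and u
  assume u: "u \<in> S" and pos: "\<rho>\<^sub>1 > 0" "\<rho>\<^sub>2 > 0" "\<sigma> > 0"
    and fu: "f u < (INF w. f w) + ereal (\<sigma> * \<rho>\<^sub>1)"
  interpret symmetrization_framework i j K S HH h star \<Theta> C by fact
  interpret i: bounded_linear i by (rule embed_XV)
  define \<rho> where "\<rho> = \<rho>\<^sub>1 + \<rho>\<^sub>2"
  \<comment> \<open>With this slope \<open>s * \<rho>\<close> is exactly the allowed excess
    \<open>\<sigma> * \<rho>\<^sub>1\<close> over the infimum, so Ekeland's point stays within
    \<open>\<rho>\<close> of its start, while \<open>s < \<sigma>\<close> leaves room for
    (c).\<close>
  define s where "s = \<sigma> * \<rho>\<^sub>1 / \<rho>"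
  have \<rho>: "\<rho> > 0" and s: "s > 0" "s < \<sigma>" and s\<rho>: "s * \<rho> = \<sigma> * \<rho>\<^sub>1"
    using pos by (auto simp: \<rho>_def s_def field_simps)
  obtain Hs where Hs: "\<forall>m. Hs m \<in> topspace HH"
    and lim: "(\<lambda>m. i (iter_pol h Hs u m)) \<longlonglongrightarrow> i (star u)"
    using iter_pol_approx u by blast
  obtain m where m: "norm (i (iter_pol h Hs u m) - i (star u)) < \<rho>"
    using LIMSEQ_D[OF lim \<rho>] by blast
  define x where "x = iter_pol h Hs u m"
  have x: "x \<in> S" "star x = star u"
    unfolding x_def using iter_pol_invariants[OF Hs u] by auto
  have "f (iter_pol h Hs u k) \<le> f u" for k
  proof (induction k)
    case (Suc k)
    then show ?case
      using assms(6) iter_pol_invariants(1)[OF Hs u, of k] Hs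
      by (auto intro: order_trans)
  qed simp
  then have fx: "f x < (INF w. f w) + ereal (s * \<rho>)"
    using fu unfolding x_def s\<rho> by (blast intro: le_less_trans)
  have fx_fin: "f x \<noteq> \<infinity>" using fx by auto
  obtain v where v1: "f v + ereal (s * dist x v) \<le> f x"
    and v2: "\<And>w. f v \<le> f w + ereal (s * dist v w)"
    using ekeland_variational_principle[OF assms(4,5) fx_fin s(1)] by blast
  obtain a where a: "f v = ereal a"
    using v1 fx_fin assms(2) by (cases "f v") auto
  \<comment> \<open>The infimum is at most \<open>f v\<close>; as \<open>f v\<close> is finite, it
    cancels and leaves the distance bound.\<close>
  have "f v + ereal (s * dist x v) < f v + ereal (s * \<rho>)"
    using v1 fx add_right_mono[OF INF_lower[of v UNIV f], of "ereal (s * \<rho>)"]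
    by (auto intro: le_less_trans less_le_trans)
  then have "dist x v < \<rho>" using s(1) by (simp add: a)
  have "norm (i v - i (star (\<Theta> v)))
      \<le> norm (i v - i x) + norm (i x - i (star u)) + norm (i (star x) - i (star (\<Theta> v)))"
    using norm_triangle_ineq[of "i v - i x + (i x - i (star u))" "i (star u) - i (star (\<Theta> v))"]
      norm_triangle_ineq[of "i v - i x" "i x - i (star u)"]
    by (simp add: x(2))
  \<comment> \<open>Here \<open>\<Theta> x = x\<close> because \<open>x\<close> is in
    \<open>S\<close>, so the Lipschitz bound for \<open>\<Theta>\<close> compares
    \<open>\<Theta> v\<close> with \<open>x\<close> itself.\<close>
  also have "norm (i (star x) - i (star (\<Theta> v))) \<le> C * norm (i v - i x)"
    using star_contraction[OF x(1) \<Theta>_closed, of v] \<Theta>_lipschitz[of x v] \<Theta>_id[OF x(1)]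
    by (simp add: norm_minus_commute)
  also have "norm (i v - i x) + norm (i x - i (star u)) + C * norm (i v - i x)
      = (C + 1) * norm (i v - i x) + norm (i x - i (star u))"
    by (simp add: algebra_simps)
  also have "\<dots> < (C + 1) * (K * \<rho>) + \<rho>"
  proof (rule add_le_less_mono)
    have "norm (i v - i x) \<le> K * dist x v"
      using K_bound[of "v - x"] by (simp add: i.diff dist_norm norm_minus_commute)
    also have "\<dots> \<le> K * \<rho>"
      using \<open>dist x v < \<rho>\<close> K_pos by simp
    finally show "(C + 1) * norm (i v - i x) \<le> (C + 1) * (K * \<rho>)"
      using C_pos by (intro mult_left_mono) auto
  qed (use m in \<open>simp add: x_def\<close>)
  finally have A: "norm (i v - i (star (\<Theta> v))) < (K * (C + 1) + 1) * (\<rho>\<^sub>1 + \<rho>\<^sub>2)"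
    by (simp add: \<rho>_def algebra_simps)
  \<comment> \<open>Ekeland's inequality has slope \<open>s\<close>, so adding
    \<open>(\<sigma> - s) * norm (w - v)\<close> to both sides leaves a surplus growing linearly
    with the distance. Its nonnegativity gives (b), its growth gives (c).\<close>
  have gap: "ereal (a + (\<sigma> - s) * norm (w - v)) \<le> f w + ereal (\<sigma> * norm (w - v))" for w
    using v2[of w] assms(2) unfolding a
    by (cases "f w") (auto simp: dist_norm norm_minus_commute algebra_simps)
  have B: "f w \<ge> f v - ereal (\<sigma> * norm (w - v))" for w
  proof -
    have "0 \<le> (\<sigma> - s) * norm (w - v)" using s(2) by simp
    then show ?thesis
      using gap[of w] assms(2) unfolding a by (cases "f w") auto
  qed
  have D: "us \<longlonglongrightarrow> v"
    if us: "(\<lambda>n. f (us n) + ereal (\<sigma> * norm (us n - v))) \<longlonglongrightarrow> f v" for us :: "nat \<Rightarrow> 'x"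
  proof (rule tendstoI)
    fix e :: real assume e: "e > 0"
    \<comment> \<open>Once the perturbed values fall below this threshold, \<open>gap\<close> forces
      \<open>(\<sigma> - s) * norm (us n - v) < (\<sigma> - s) * e\<close>.\<close>
    have "f v < ereal (a + (\<sigma> - s) * e)" using e s(2) by (simp add: a)
    from order_tendstoD(2)[OF us this] show "\<forall>\<^sub>F n in sequentially. dist (us n) v < e"
    proof eventually_elim
      case (elim n)
      from le_less_trans[OF gap this] show ?case
        using s(2) by (simp add: dist_norm)
    qed
  qed
  show "\<exists>v. norm (i v - i (star (\<Theta> v))) < (K * (C + 1) + 1) * (\<rho>\<^sub>1 + \<rho>\<^sub>2) \<and>
      (\<forall>w. f w \<ge> f v - ereal (\<sigma> * norm (w - v))) \<and>
      (\<forall>us :: nat \<Rightarrow> 'x.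
        (\<lambda>n. f (us n) + ereal (\<sigma> * norm (us n - v))) \<longlonglongrightarrow> f v \<longrightarrow> us \<longlonglongrightarrow> v)"
    using A B D by blast
qed

end
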